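(* For a normal space $X$ the following are equivalent: (1) $X$ is connected modulo realcompactness; (2) $\mathrm{cl}_{\beta X}(\upsilon X\setminus X)$ is connected.
   Context: Normal spaces are understood to be Hausdorff (hence Tychonoff). $\beta X$ is the Stone--Čech compactification and $\upsilon X$ the Hewitt realcompactification of $X$, with $X\subseteq\upsilon X\subseteq\beta X$. A space is realcompact if it is homeomorphic to a closed subspace of some product $\mathbb{R}^\alpha$. An ideal in a set $X$ is a non-empty collection of subsets of $X$ closed under taking subsets and under binary unions (it need not be proper). The ideal $\langle\mathscr{A}\rangle$ generated by a collection $\mathscr{A}$ of subsets of $X$ is the intersection of all ideals in $X$ containing $\mathscr{A}$. For an ideal $\mathscr{H}$ in a space $X$, a mapping $f:X\to[0,1]$ is $2$-valued modulo $\mathscr{H}$ if $f^{-1}(0)\notin\mathscr{H}$, $f^{-1}(1)\notin\mathscr{H}$ and $X\setminus(f^{-1}(0)\cup f^{-1}(1))\in\mathscr{H}$; the space $X$ is connected modulo $\mathscr{H}$ if there is no continuous $f:X\to[0,1]$ which is $2$-valued modulo $\mathscr{H}$. For a normal space $X$ let $\mathscr{R}_X=\langle R: R\subseteq X$ and $\mathrm{cl}_XR$ is realcompact$\rangle$; a normal space $X$ is connected modulo realcompactness if it is connected modulo $\mathscr{R}_X$. The empty space counts as connected. *)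

theory Defs
  imports "HOL-Analysis.Analysis"
begin

section \<open>Realcompact spaces\<close>

text \<open>A definition cannot quantify over the type of the index set of the power of the real line.
  The index sets here are sets of real functions on the underlying type; by
  \<open>realcompact_spaceI\<close> below, index sets of any other type give the same spaces.\<close>

definition realcompact_space :: "'a topology \<Rightarrow> bool" where
  "realcompact_space X \<longleftrightarrow>
     (\<exists>(I :: ('a \<Rightarrow> real) set) T. closedin (powertop_real I) T \<and>
        X homeomorphic_space subtopology (powertop_real I) T)"

lemma realcompact_spaceI:
  fixes X :: "'a topology" and J :: "'c set"
  assumes T: "closedin (powertop_real J) T"
    and hom: "X homeomorphic_space subtopology (powertop_real J) T"
  shows "realcompact_space X"
proof -
  obtain h k where hk: "homeomorphic_maps X (subtopology (powertop_real J) T) h k"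
    using hom homeomorphic_space_def by blast
  have conth: "continuous_map X (subtopology (powertop_real J) T) h"
    and contk: "continuous_map (subtopology (powertop_real J) T) X k"
    and kh: "\<And>x. x \<in> topspace X \<Longrightarrow> k (h x) = x"
    and hk': "\<And>y. y \<in> topspace (subtopology (powertop_real J) T) \<Longrightarrow> h (k y) = y"
    using hk by (auto simp: homeomorphic_maps_def)
  have Tsub: "T \<subseteq> topspace (powertop_real J)"
    using T closedin_subset by blast
  have topT: "topspace (subtopology (powertop_real J) T) = T"
    using Tsub by auto
  have hT: "h x \<in> T" if "x \<in> topspace X" for x
    using conth that topT by (metis continuous_map_image_subset_topspace image_subset_iff)
  have kX: "k y \<in> topspace X" if "y \<in> T" for y
    using contk that topT by (metis continuous_map_image_subset_topspace image_subset_iff)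
  define c where "c j = (\<lambda>x. h x j)" for j
  define I where "I = c ` J"
  define \<Phi> where "\<Phi> z = (\<lambda>j\<in>J. z (c j))" for z :: "('a \<Rightarrow> real) \<Rightarrow> real"
  define T' where "T' = {z \<in> topspace (powertop_real I). \<Phi> z \<in> T}"
  define \<Psi> where "\<Psi> x = (\<lambda>f\<in>I. f x)" for x :: 'a
  have cont\<Phi>: "continuous_map (powertop_real I) (powertop_real J) \<Phi>"
    unfolding continuous_map_componentwise
  proof (intro conjI ballI)
    show "\<Phi> ` topspace (powertop_real I) \<subseteq> extensional J"
      by (auto simp: \<Phi>_def)
    fix j assume j: "j \<in> J"
    then have "continuous_map (powertop_real I) euclideanreal (\<lambda>z. z (c j))"
      using continuous_map_product_projection[of "c j" I "\<lambda>_. euclideanreal"] by (auto simp: I_def)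
    then show "continuous_map (powertop_real I) euclideanreal (\<lambda>z. \<Phi> z j)"
      using j by (simp add: \<Phi>_def)
  qed
  have closed: "closedin (powertop_real I) T'"
    unfolding T'_def using closedin_continuous_map_preimage[OF cont\<Phi> T] .
  have \<Phi>\<Psi>: "\<Phi> (\<Psi> x) = h x" if "x \<in> topspace X" for x
  proof -
    have "h x \<in> extensional J"
      using hT[OF that] Tsub by (auto simp: PiE_def)
    then show ?thesis
      by (auto simp: \<Phi>_def \<Psi>_def I_def c_def fun_eq_iff extensional_def)
  qed
  have cont\<Psi>: "continuous_map X (powertop_real I) \<Psi>"
    unfolding continuous_map_componentwise
  proof (intro conjI ballI)
    show "\<Psi> ` topspace X \<subseteq> extensional I"
      by (auto simp: \<Psi>_def)
    fix f assume f: "f \<in> I"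
    then obtain j where j: "j \<in> J" "f = c j"
      by (auto simp: I_def)
    have "continuous_map X (powertop_real J) h"
      using conth continuous_map_in_subtopology by blast
    then have "continuous_map X euclideanreal (\<lambda>x. h x j)"
      using j by (simp add: continuous_map_componentwise)
    then show "continuous_map X euclideanreal (\<lambda>x. \<Psi> x f)"
      using f j by (simp add: \<Psi>_def c_def)
  qed
  have \<Psi>T: "\<Psi> x \<in> T'" if "x \<in> topspace X" for x
    using that \<Phi>\<Psi> hT by (auto simp: T'_def \<Psi>_def)
  have "homeomorphic_maps X (subtopology (powertop_real I) T') \<Psi> (\<lambda>z. k (\<Phi> z))"
    unfolding homeomorphic_maps_def
  proof (intro conjI ballI)
    show "continuous_map X (subtopology (powertop_real I) T') \<Psi>"
      using cont\<Psi> \<Psi>T by (auto simp: continuous_map_in_subtopology)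
    have "continuous_map (subtopology (powertop_real I) T') (subtopology (powertop_real J) T) \<Phi>"
      using cont\<Phi> by (auto simp: continuous_map_in_subtopology T'_def continuous_map_from_subtopology)
    then have "continuous_map (subtopology (powertop_real I) T') X (k \<circ> \<Phi>)"
      using contk continuous_map_compose by blast
    then show "continuous_map (subtopology (powertop_real I) T') X (\<lambda>z. k (\<Phi> z))"
      by (simp add: o_def)
    show "k (\<Phi> (\<Psi> x)) = x" if "x \<in> topspace X" for x
      using that by (simp add: \<Phi>\<Psi> kh)
    fix z assume z: "z \<in> topspace (subtopology (powertop_real I) T')"
    then have zI: "z \<in> extensional I" and zT: "\<Phi> z \<in> T"
      by (auto simp: T'_def PiE_def)
    show "\<Psi> (k (\<Phi> z)) = z"
    proof
      fix f
      show "\<Psi> (k (\<Phi> z)) f = z f"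
      proof (cases "f \<in> I")
        case False
        then show ?thesis
          using zI by (simp add: \<Psi>_def extensional_def)
      next
        case True
        then obtain j where j: "j \<in> J" "f = c j"
          by (auto simp: I_def)
        have "\<Psi> (k (\<Phi> z)) f = h (k (\<Phi> z)) j"
          using True j by (simp add: \<Psi>_def c_def)
        also have "\<dots> = \<Phi> z j"
          using hk'[of "\<Phi> z"] zT by (simp only: topT)
        also have "\<dots> = z f"
          using j by (simp add: \<Phi>_def)
        finally show ?thesis .
      qed
    qed
  qed
  then show ?thesis
    unfolding realcompact_space_def homeomorphic_space_def using closed by blast
qed


section \<open>The Stone--Cech compactification\<close>

definition unit_functions :: "'a topology \<Rightarrow> ('a \<Rightarrow> real) set" where
  "unit_functions X =
     {f \<in> extensional (topspace X). continuous_map X (top_of_set {0..1}) f}"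

abbreviation unit_cube :: "'a topology \<Rightarrow> (('a \<Rightarrow> real) \<Rightarrow> real) topology" where
  "unit_cube X \<equiv> product_topology (\<lambda>_. top_of_set {0..1}) (unit_functions X)"

definition stone_cech_map :: "'a topology \<Rightarrow> 'a \<Rightarrow> ('a \<Rightarrow> real) \<Rightarrow> real" where
  "stone_cech_map X x = (\<lambda>f \<in> unit_functions X. f x)"

text \<open>For a Tychonoff space \<open>X\<close>, the space \<open>stone_cech X\<close> together with the dense embedding
  \<open>stone_cech_map X\<close>; the copy of \<open>X\<close> inside is \<open>stone_cech_map X ` topspace X\<close>.\<close>

definition stone_cech :: "'a topology \<Rightarrow> (('a \<Rightarrow> real) \<Rightarrow> real) topology" where
  "stone_cech X =
     subtopology (unit_cube X) (unit_cube X closure_of (stone_cech_map X ` topspace X))"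

lemma continuous_map_stone_cech_map_cube:
  "continuous_map X (unit_cube X) (stone_cech_map X)"
  unfolding continuous_map_componentwise
  by (auto simp: stone_cech_map_def unit_functions_def)

lemma stone_cech_map_in_cube:
  "stone_cech_map X ` topspace X \<subseteq> topspace (unit_cube X)"
  by (rule continuous_map_image_subset_topspace[OF continuous_map_stone_cech_map_cube])

lemma topspace_stone_cech:
  "topspace (stone_cech X) = unit_cube X closure_of (stone_cech_map X ` topspace X)"
  unfolding stone_cech_def using closure_of_subset_topspace by fastforce

lemma stone_cech_map_in:
  "stone_cech_map X ` topspace X \<subseteq> topspace (stone_cech X)"
  unfolding topspace_stone_cech by (rule closure_of_subset[OF stone_cech_map_in_cube])

lemma continuous_map_stone_cech_map: "continuous_map X (stone_cech X) (stone_cech_map X)"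
proof -
  have "stone_cech_map X \<in> topspace X
          \<rightarrow> unit_cube X closure_of (stone_cech_map X ` topspace X)"
    using stone_cech_map_in[of X] unfolding topspace_stone_cech by blast
  then show ?thesis
    unfolding stone_cech_def
    by (rule continuous_map_into_subtopology[OF continuous_map_stone_cech_map_cube])
qed

lemma compact_space_stone_cech: "compact_space (stone_cech X)"
proof -
  have "compact_space (unit_cube X)"
    by (simp add: compact_space_product_topology compact_space_subtopology)
  then show ?thesis
    unfolding stone_cech_def
    by (simp add: closedin_compact_space compact_space_subtopology)
qed

lemma Hausdorff_space_stone_cech: "Hausdorff_space (stone_cech X)"
  unfolding stone_cech_def
  by (intro Hausdorff_space_subtopology)
     (simp add: Hausdorff_space_product_topology Hausdorff_space_subtopology)

lemma stone_cech_map_dense: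
  "stone_cech X closure_of (stone_cech_map X ` topspace X) = topspace (stone_cech X)"
proof -
  have "stone_cech_map X ` topspace X
          \<subseteq> unit_cube X closure_of (stone_cech_map X ` topspace X)"
    by (rule closure_of_subset[OF stone_cech_map_in_cube])
  then show ?thesis
    unfolding topspace_stone_cech
    by (simp add: stone_cech_def closure_of_subtopology inf.absorb2)
qed

lemma embedding_map_stone_cech_map:
  assumes "completely_regular_space X" "Hausdorff_space X"
  shows "embedding_map X (stone_cech X) (stone_cech_map X)"
proof -
  have "mspace (submetric (cfunspace X euclidean_metric) {f. f \<in> topspace X \<rightarrow> {0..1::real}})
          = unit_functions X"
  proof -
    have "bounded (f ` topspace X)" if "f \<in> topspace X \<rightarrow> {0..1::real}" for f
      using that by (metis bounded_closed_interval bounded_subset image_subset_iff_funcset)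
    then show ?thesis
      by (auto simp: unit_functions_def continuous_map_in_subtopology)
  qed
  then have "embedding_map X (unit_cube X) (stone_cech_map X)"
    using completely_regular_space_cube_embedding_explicit[OF assms]
    by (simp add: stone_cech_map_def[abs_def])
  moreover have "subtopology (stone_cech X) (stone_cech_map X ` topspace X)
      = subtopology (unit_cube X) (stone_cech_map X ` topspace X)"
    using stone_cech_map_in[of X] unfolding topspace_stone_cech
    by (simp add: stone_cech_def subtopology_subtopology inf.absorb2)
  ultimately show ?thesis
    by (simp add: embedding_map_def)
qed

lemma continuous_map_stone_cech_projection:
  assumes "f \<in> unit_functions X"
  shows "continuous_map (stone_cech X) (top_of_set {0..1}) (\<lambda>p. p f)"
  unfolding stone_cech_def
  using continuous_map_product_projection[OF assms] continuous_map_from_subtopology by blast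

lemma stone_cech_extension:
  assumes "continuous_map X (top_of_set {0..1::real}) f"
  obtains g where "continuous_map (stone_cech X) (top_of_set {0..1}) g"
    "\<And>x. x \<in> topspace X \<Longrightarrow> g (stone_cech_map X x) = f x"
proof -
  have "continuous_map X (top_of_set {0..1}) (restrict f (topspace X))"
    using assms by (rule continuous_map_eq) simp
  then have r: "restrict f (topspace X) \<in> unit_functions X"
    by (simp add: unit_functions_def)
  show thesis
    using that[OF continuous_map_stone_cech_projection[OF r]] r
    by (simp add: stone_cech_map_def)
qed


section \<open>The Hewitt realcompactification\<close>

text \<open>The Hewitt realcompactification of a Tychonoff space \<open>X\<close>, placed inside the Stone--Cech
  compactification: a realcompact space containing \<open>X\<close> (densely) to which
  every continuous real-valued function on \<open>X\<close> extends.\<close>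

definition is_hewitt_realcompactification ::
    "'a topology \<Rightarrow> (('a \<Rightarrow> real) \<Rightarrow> real) set \<Rightarrow> bool" where
  "is_hewitt_realcompactification X U \<longleftrightarrow>
     stone_cech_map X ` topspace X \<subseteq> U \<and> U \<subseteq> topspace (stone_cech X) \<and>
     realcompact_space (subtopology (stone_cech X) U) \<and>
     (\<forall>f. continuous_map X euclideanreal f \<longrightarrow>
        (\<exists>g. continuous_map (subtopology (stone_cech X) U) euclideanreal g \<and>
             (\<forall>x \<in> topspace X. g (stone_cech_map X x) = f x)))"

text \<open>Well defined by \<open>is_hewitt_realcompactification_hewitt\<close> and
  \<open>is_hewitt_realcompactification_unique\<close> below.\<close>

definition hewitt_realcompactification :: "'a topology \<Rightarrow> (('a \<Rightarrow> real) \<Rightarrow> real) set" where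
  "hewitt_realcompactification X = (THE U. is_hewitt_realcompactification X U)"

lemma dense_in_between:
  assumes "stone_cech_map X ` topspace X \<subseteq> U" "U \<subseteq> topspace (stone_cech X)"
  shows "subtopology (stone_cech X) U closure_of (stone_cech_map X ` topspace X) = U"
  using assms stone_cech_map_dense[of X]
  by (simp add: closure_of_subtopology inf.absorb1 inf.absorb2)

lemma is_hewitt_realcompactification_subset:
  assumes V: "is_hewitt_realcompactification X V" and W: "is_hewitt_realcompactification X W"
  shows "V \<subseteq> W"
proof
  fix p assume p: "p \<in> V"
  let ?e = "stone_cech_map X"
  let ?B = "stone_cech X"
  have eV: "?e ` topspace X \<subseteq> V" and VB: "V \<subseteq> topspace ?B"
    and eW: "?e ` topspace X \<subseteq> W" and WB: "W \<subseteq> topspace ?B"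
    using V W by (auto simp: is_hewitt_realcompactification_def)
  have topV: "topspace (subtopology ?B V) = V" and topW: "topspace (subtopology ?B W) = W"
    using VB WB by auto
  obtain I :: "((('a \<Rightarrow> real) \<Rightarrow> real) \<Rightarrow> real) set" and T
    where T: "closedin (powertop_real I) T"
    and "subtopology ?B W homeomorphic_space subtopology (powertop_real I) T"
    using W unfolding is_hewitt_realcompactification_def realcompact_space_def by blast
  then obtain h k where hk: "homeomorphic_maps (subtopology ?B W) (subtopology (powertop_real I) T) h k"
    using homeomorphic_space_def by blast
  have conth: "continuous_map (subtopology ?B W) (powertop_real I) h"
    and hWT: "\<And>w. w \<in> W \<Longrightarrow> h w \<in> T"
    and contk: "continuous_map (subtopology (powertop_real I) T) (subtopology ?B W) k"
    and kh: "\<And>w. w \<in> W \<Longrightarrow> k (h w) = w"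
    using hk topW by (auto simp: homeomorphic_maps_def continuous_map_in_subtopology)
  have conte: "continuous_map X (subtopology ?B W) ?e"
    using eW by (intro continuous_map_into_subtopology[OF continuous_map_stone_cech_map]) blast
  have "\<forall>i\<in>I. \<exists>g. continuous_map (subtopology ?B V) euclideanreal g \<and>
          (\<forall>x \<in> topspace X. g (?e x) = h (?e x) i)"
  proof
    fix i assume i: "i \<in> I"
    have "continuous_map (subtopology ?B W) euclideanreal (\<lambda>w. h w i)"
      using conth i by (simp add: continuous_map_componentwise)
    then have "continuous_map X euclideanreal (\<lambda>x. h (?e x) i)"
      using continuous_map_compose[OF conte] by (fastforce simp: o_def)
    then show "\<exists>g. continuous_map (subtopology ?B V) euclideanreal g \<and>
          (\<forall>x \<in> topspace X. g (?e x) = h (?e x) i)"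
      using V by (simp add: is_hewitt_realcompactification_def)
  qed
  then obtain g where contg: "\<And>i. i \<in> I \<Longrightarrow> continuous_map (subtopology ?B V) euclideanreal (g i)"
    and g: "\<And>i x. i \<in> I \<Longrightarrow> x \<in> topspace X \<Longrightarrow> g i (?e x) = h (?e x) i"
    by metis
  define H where "H p = (\<lambda>i\<in>I. g i p)" for p
  have contH: "continuous_map (subtopology ?B V) (powertop_real I) H"
    unfolding continuous_map_componentwise using contg by (auto simp: H_def)
  have He: "H (?e x) = h (?e x)" if x: "x \<in> topspace X" for x
  proof -
    have "h (?e x) \<in> extensional I"
      using closedin_subset[OF T] hWT eW x by (fastforce simp: PiE_def)
    then show ?thesis
      using g x by (auto simp: H_def fun_eq_iff extensional_def)
  qed
  have dense: "q \<in> subtopology ?B V closure_of (?e ` topspace X)" if "q \<in> V" for q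
    using dense_in_between[OF eV VB] that by simp
  have HT: "H q \<in> T" if q: "q \<in> V" for q
  proof (rule forall_in_closure_of[OF dense[OF q], where P="\<lambda>q. H q \<in> T"])
    show "H y \<in> T" if "y \<in> ?e ` topspace X" for y
      using that He hWT eW by auto
    show "closedin (subtopology ?B V) {q \<in> topspace (subtopology ?B V). H q \<in> T}"
      using closedin_continuous_map_preimage[OF contH T] .
  qed
  have "continuous_map (subtopology ?B V) (subtopology (powertop_real I) T) H"
    using contH HT topV by (auto simp: continuous_map_in_subtopology)
  then have contkH: "continuous_map (subtopology ?B V) (subtopology ?B W) (k \<circ> H)"
    using contk continuous_map_compose by blast
  have "(k \<circ> H) p = id p"
  proof (rule forall_in_closure_of_eq[OF dense[OF p] Hausdorff_space_stone_cech[of X]])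
    show "continuous_map (subtopology ?B V) ?B (k \<circ> H)"
      using contkH continuous_map_in_subtopology by blast
    show "continuous_map (subtopology ?B V) ?B id"
      by (simp add: continuous_map_from_subtopology)
    show "(k \<circ> H) y = id y" if "y \<in> ?e ` topspace X" for y
      using that He kh eW by auto
  qed
  moreover have "(k \<circ> H) p \<in> W"
    using contkH p topV topW by (metis continuous_map_image_subset_topspace image_subset_iff)
  ultimately show "p \<in> W"
    by simp
qed

lemma is_hewitt_realcompactification_unique:
  assumes "is_hewitt_realcompactification X V" "is_hewitt_realcompactification X W"
  shows "V = W"
  using assms is_hewitt_realcompactification_subset by blast

lemma is_hewitt_realcompactification_exists:
  "\<exists>U. is_hewitt_realcompactification X U"
proof -
  let ?e = "stone_cech_map X"
  let ?B = "stone_cech X"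
  define s :: "real \<Rightarrow> real" where "s x = 1/2 + arctan x / pi" for x
  define t :: "real \<Rightarrow> real" where "t y = tan (pi * (y - 1/2))" for y
  have s01: "0 < s x \<and> s x < 1" for x
    using arctan_bounded[of x] pi_gt_zero by (auto simp: s_def field_simps)
  have ts: "t (s x) = x" for x
    by (simp add: s_def t_def arctan)
  have conts: "continuous_on UNIV s"
    unfolding s_def by (intro continuous_intros) auto
  have contt: "continuous_on {0<..<1} t"
    unfolding t_def
  proof (intro continuous_intros ballI)
    fix y :: real assume y: "y \<in> {0<..<1}"
    have "cos (pi * (y - 1/2)) > 0"
      using y by (intro cos_gt_zero_pi) (auto simp: field_simps)
    then show "cos (pi * (y - 1/2)) \<noteq> 0" by simp
  qed
  define C where "C = {f. continuous_map X euclideanreal f}"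
  define \<phi> where "\<phi> f = restrict (\<lambda>x. s (f x)) (topspace X)" for f :: "'a \<Rightarrow> real"
  have unitC: "unit_functions X \<subseteq> C"
    by (auto simp: unit_functions_def C_def continuous_map_in_subtopology)
  have \<phi>u: "\<phi> f \<in> unit_functions X" if "f \<in> C" for f
  proof -
    have "continuous_map X euclideanreal (s \<circ> f)"
      using that conts unfolding C_def
      by (intro continuous_map_compose[where X'=euclideanreal]) auto
    then have "continuous_map X (top_of_set {0..1}) (\<lambda>x. s (f x))"
      using s01 by (auto simp: continuous_map_in_subtopology o_def less_imp_le)
    then have "continuous_map X (top_of_set {0..1}) (\<phi> f)"
      by (rule continuous_map_eq) (simp add: \<phi>_def)
    then show ?thesis
      by (simp add: unit_functions_def \<phi>_def)
  qed
  have e\<phi>: "?e x (\<phi> f) = s (f x)" if "f \<in> C" "x \<in> topspace X" for f x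
    using that \<phi>u by (simp add: stone_cech_map_def) (simp add: \<phi>_def)
  define U where "U = {p \<in> topspace ?B. \<forall>f\<in>C. p (\<phi> f) \<in> {0<..<1}}"
  have eU: "?e ` topspace X \<subseteq> U"
    using stone_cech_map_in[of X] e\<phi> s01 by (auto simp: U_def)
  have UB: "U \<subseteq> topspace ?B"
    by (auto simp: U_def)
  have topU: "topspace (subtopology ?B U) = U"
    using UB by auto
  have conttp: "continuous_map (subtopology ?B U) euclideanreal (\<lambda>p. t (p (\<phi> f)))"
    if f: "f \<in> C" for f
  proof -
    have "continuous_map (subtopology ?B U) euclideanreal (\<lambda>p. p (\<phi> f))"
      using continuous_map_stone_cech_projection[OF \<phi>u[OF f]]
      by (auto simp: continuous_map_in_subtopology continuous_map_from_subtopology)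
    then have "continuous_map (subtopology ?B U) (top_of_set {0<..<1}) (\<lambda>p. p (\<phi> f))"
      using f by (auto simp: continuous_map_in_subtopology U_def)
    moreover have "continuous_map (top_of_set {0<..<1}) euclideanreal t"
      using contt by simp
    ultimately have "continuous_map (subtopology ?B U) euclideanreal (t \<circ> (\<lambda>p. p (\<phi> f)))"
      by (rule continuous_map_compose)
    then show ?thesis by (simp add: o_def)
  qed
  define h where "h p = (\<lambda>f\<in>C. t (p (\<phi> f)))" for p :: "('a \<Rightarrow> real) \<Rightarrow> real"
  define k where "k z = (\<lambda>f\<in>unit_functions X. z f)" for z :: "('a \<Rightarrow> real) \<Rightarrow> real"
  have conth: "continuous_map (subtopology ?B U) (powertop_real C) h"
    unfolding continuous_map_componentwise using conttp by (auto simp: h_def)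
  have he: "h (?e x) f = f x" if "f \<in> C" "x \<in> topspace X" for f x
    using that by (simp add: h_def e\<phi> ts)
  define E where "E = h ` ?e ` topspace X"
  define T where "T = powertop_real C closure_of E"
  have Etop: "E \<subseteq> topspace (powertop_real C)"
    by (auto simp: E_def h_def)
  have closedT: "closedin (powertop_real C) T"
    by (simp add: T_def)
  have ET: "E \<subseteq> T"
    unfolding T_def by (rule closure_of_subset[OF Etop])
  have topT: "topspace (subtopology (powertop_real C) T) = T"
    using closedin_subset[OF closedT] by auto
  have denseT: "z \<in> subtopology (powertop_real C) T closure_of E" if "z \<in> T" for z
    using that ET by (simp add: closure_of_subtopology inf.absorb2) (simp add: T_def)
  have projT: "continuous_map (subtopology (powertop_real C) T) euclideanreal (\<lambda>z. z f)"
    if "f \<in> C" for f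
    using continuous_map_product_projection[OF that, of "\<lambda>_. euclideanreal"]
      continuous_map_from_subtopology by blast
  have denseU: "p \<in> subtopology ?B U closure_of (?e ` topspace X)" if "p \<in> U" for p
    using dense_in_between[OF eU UB] that by simp
  have hU: "h p \<in> T" if "p \<in> U" for p
    using continuous_map_image_closure_subset[OF conth, of "?e ` topspace X"] denseU[OF that]
    by (auto simp: T_def E_def)
  have T01: "z f \<in> {0..1}" if z: "z \<in> T" and f: "f \<in> unit_functions X" for z f
  proof (rule forall_in_closure_of[OF denseT[OF z], where P="\<lambda>z. z f \<in> {0..1}"])
    have fC: "f \<in> C" using f unitC by blast
    show "y f \<in> {0..1}" if "y \<in> E" for y
    proof -
      obtain x where "x \<in> topspace X" "y = h (?e x)"
        using \<open>y \<in> E\<close> by (auto simp: E_def)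
      then have "y f = f x" using he[OF fC] by simp
      then show ?thesis
        using f \<open>x \<in> topspace X\<close> by (auto simp: unit_functions_def continuous_map_in_subtopology)
    qed
    show "closedin (subtopology (powertop_real C) T)
            {z \<in> topspace (subtopology (powertop_real C) T). z f \<in> {0..1}}"
      by (rule closedin_continuous_map_preimage[OF projT[OF fC]]) simp
  qed
  have contk: "continuous_map (subtopology (powertop_real C) T) (unit_cube X) k"
    unfolding continuous_map_componentwise
  proof (intro conjI ballI)
    show "k ` topspace (subtopology (powertop_real C) T) \<subseteq> extensional (unit_functions X)"
      by (auto simp: k_def)
    fix f assume f: "f \<in> unit_functions X"
    then have "continuous_map (subtopology (powertop_real C) T) (top_of_set {0..1}) (\<lambda>z. z f)"
      using projT[of f] unitC T01 topT by (auto simp: continuous_map_in_subtopology)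
    then show "continuous_map (subtopology (powertop_real C) T) (top_of_set {0..1}) (\<lambda>z. k z f)"
      using f by (simp add: k_def)
  qed
  have khe: "k (h (?e x)) = ?e x" if "x \<in> topspace X" for x
    using that he unitC by (auto simp: k_def stone_cech_map_def fun_eq_iff)
  have kB: "k z \<in> topspace ?B" if "z \<in> T" for z
  proof -
    have "k ` E = ?e ` topspace X"
      using khe by (force simp: E_def image_iff)
    then show ?thesis
      using continuous_map_image_closure_subset[OF contk, of E] denseT[OF that]
      by (auto simp: topspace_stone_cech)
  qed
  have k\<phi>: "k z (\<phi> f) = s (z f)" if z: "z \<in> T" and f: "f \<in> C" for z f
  proof -
    have "z (\<phi> f) = (s \<circ> (\<lambda>z. z f)) z"
    proof (rule forall_in_closure_of_eq[OF denseT[OF z], where Y=euclideanreal and f="\<lambda>z. z (\<phi> f)"])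
      show "continuous_map (subtopology (powertop_real C) T) euclideanreal (\<lambda>z. z (\<phi> f))"
        using projT \<phi>u[OF f] unitC by blast
      show "continuous_map (subtopology (powertop_real C) T) euclideanreal (s \<circ> (\<lambda>z. z f))"
        using conts by (intro continuous_map_compose[OF projT[OF f]]) auto
      fix y assume "y \<in> E"
      then obtain x where x: "x \<in> topspace X" "y = h (?e x)"
        by (auto simp: E_def)
      have "\<phi> f \<in> C" using \<phi>u[OF f] unitC by blast
      then have "y (\<phi> f) = \<phi> f x" using he x by simp
      then show "y (\<phi> f) = (s \<circ> (\<lambda>z. z f)) y"
        using he[OF f] x by (simp add: \<phi>_def)
    qed auto
    then show ?thesis
      using \<phi>u[OF f] by (simp add: k_def)
  qed
  have kU: "k z \<in> U" if "z \<in> T" for z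
    using kB[OF that] k\<phi>[OF that] s01 by (auto simp: U_def)
  have kh: "k (h p) = p" if p: "p \<in> U" for p
  proof -
    have "continuous_map (subtopology ?B U) (subtopology (powertop_real C) T) h"
      using conth hU topU by (auto simp: continuous_map_in_subtopology)
    then have "continuous_map (subtopology ?B U) (unit_cube X) (k \<circ> h)"
      using contk continuous_map_compose by blast
    then have "continuous_map (subtopology ?B U) ?B (k \<circ> h)"
      using kB hU topU
      by (auto simp: stone_cech_def[of X] continuous_map_in_subtopology topspace_stone_cech)
    moreover have "continuous_map (subtopology ?B U) ?B id"
      by (simp add: continuous_map_from_subtopology)
    moreover have "(k \<circ> h) y = id y" if "y \<in> ?e ` topspace X" for y
      using that khe by auto
    ultimately have "(k \<circ> h) p = id p"
      by (rule forall_in_closure_of_eq[OF denseU[OF p] Hausdorff_space_stone_cech[of X]])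
    then show ?thesis by simp
  qed
  have hk: "h (k z) = z" if z: "z \<in> T" for z
  proof -
    have "z \<in> extensional C"
      using z closedin_subset[OF closedT] by (auto simp: PiE_def)
    then show ?thesis
      using k\<phi>[OF z] ts by (auto simp: h_def fun_eq_iff extensional_def)
  qed
  have "homeomorphic_maps (subtopology ?B U) (subtopology (powertop_real C) T) h k"
    unfolding homeomorphic_maps_def
  proof (intro conjI ballI)
    show "continuous_map (subtopology ?B U) (subtopology (powertop_real C) T) h"
      using conth hU topU by (auto simp: continuous_map_in_subtopology)
    show "continuous_map (subtopology (powertop_real C) T) (subtopology ?B U) k"
      using contk kB kU topT
      by (auto simp: stone_cech_def[of X] continuous_map_in_subtopology topspace_stone_cech)
  qed (use kh hk topU topT in auto)
  then have "realcompact_space (subtopology ?B U)"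
    using realcompact_spaceI[OF closedT] homeomorphic_space_def by blast
  moreover have "\<exists>g. continuous_map (subtopology ?B U) euclideanreal g \<and>
             (\<forall>x \<in> topspace X. g (?e x) = f x)" if "continuous_map X euclideanreal f" for f
  proof -
    have f: "f \<in> C" using that by (simp add: C_def)
    show ?thesis
      using conttp[OF f] e\<phi>[OF f] ts by (intro exI[of _ "\<lambda>p. t (p (\<phi> f))"]) auto
  qed
  ultimately have "is_hewitt_realcompactification X U"
    using eU UB by (simp add: is_hewitt_realcompactification_def)
  then show ?thesis by blast
qed

lemma is_hewitt_realcompactification_hewitt:
  "is_hewitt_realcompactification X (hewitt_realcompactification X)"
  unfolding hewitt_realcompactification_def
  using theI' is_hewitt_realcompactification_exists is_hewitt_realcompactification_unique by metis


section \<open>Connectedness modulo an ideal\<close>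

definition ideal_in :: "'a set \<Rightarrow> 'a set set \<Rightarrow> bool" where
  "ideal_in S \<H> \<longleftrightarrow> \<H> \<subseteq> Pow S \<and> \<H> \<noteq> {} \<and>
     (\<forall>A\<in>\<H>. \<forall>B. B \<subseteq> A \<longrightarrow> B \<in> \<H>) \<and> (\<forall>A\<in>\<H>. \<forall>B\<in>\<H>. A \<union> B \<in> \<H>)"

definition generated_ideal :: "'a set \<Rightarrow> 'a set set \<Rightarrow> 'a set set" where
  "generated_ideal S \<A> = \<Inter> {\<H>. ideal_in S \<H> \<and> \<A> \<subseteq> \<H>}"

definition two_valued_modulo :: "'a topology \<Rightarrow> 'a set set \<Rightarrow> ('a \<Rightarrow> real) \<Rightarrow> bool" where
  "two_valued_modulo X \<H> f \<longleftrightarrow>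
     {x \<in> topspace X. f x = 0} \<notin> \<H> \<and>
     {x \<in> topspace X. f x = 1} \<notin> \<H> \<and>
     topspace X - ({x \<in> topspace X. f x = 0} \<union> {x \<in> topspace X. f x = 1}) \<in> \<H>"

definition connected_modulo :: "'a topology \<Rightarrow> 'a set set \<Rightarrow> bool" where
  "connected_modulo X \<H> \<longleftrightarrow>
     \<not> (\<exists>f. continuous_map X (top_of_set {0..1::real}) f \<and> two_valued_modulo X \<H> f)"

definition realcompactness_ideal :: "'a topology \<Rightarrow> 'a set set" where
  "realcompactness_ideal X =
     generated_ideal (topspace X)
       {R. R \<subseteq> topspace X \<and> realcompact_space (subtopology X (X closure_of R))}"

definition connected_modulo_realcompactness :: "'a topology \<Rightarrow> bool" where
  "connected_modulo_realcompactness X \<longleftrightarrow> connected_modulo X (realcompactness_ideal X)"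

end

theory Submission
  imports Defs
begin

text \<open>Let \<open>K = \<upsilon>X - X\<close>. A set \<open>R\<close> belongs to the realcompactness ideal iff the closure of \<open>R\<close> in
  \<open>\<beta>X\<close> misses \<open>K\<close>: if it does, then the closure of \<open>R\<close> in \<open>X\<close> is closed in \<open>\<upsilon>X\<close>; conversely, closed
  subspaces \<open>A\<close> of a normal space are C-embedded, so a closed embedding of \<open>A\<close> into a power of the
  line extends to \<open>\<upsilon>X\<close> and forces \<open>A\<close> to be closed there. A function that is 2-valued modulo the
  ideal therefore extends to \<open>\<beta>X\<close> with values 0 and 1, both attained, on \<open>K\<close>; and a Urysohn function
  for a separation of the closure of \<open>K\<close>, truncated so as to be locally constant near that closure,
  restricts to a 2-valued function.\<close>

text \<open>The two spaces may live on different types, and so may the index sets of their powers of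
  the line; \<open>realcompact_spaceI\<close> accepts index sets of any type.\<close>

lemma realcompact_space_homeomorphic:
  assumes "X homeomorphic_space Y" "realcompact_space Y"
  shows "realcompact_space X"
  using assms homeomorphic_space_trans realcompact_spaceI
  unfolding realcompact_space_def[of Y] by blast

lemma realcompact_space_closed_subtopology:
  assumes "realcompact_space X" "closedin X C"
  shows "realcompact_space (subtopology X C)"
proof -
  obtain I :: "('a \<Rightarrow> real) set" and T where T: "closedin (powertop_real I) T"
    and "X homeomorphic_space subtopology (powertop_real I) T"
    using assms(1) unfolding realcompact_space_def by blast
  then obtain h where h: "homeomorphic_map X (subtopology (powertop_real I) T) h"
    using homeomorphic_space by blast
  have C: "C \<subseteq> topspace X"
    using assms(2) closedin_subset by blast
  have "closedin (subtopology (powertop_real I) T) (h ` C)"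
    using homeomorphic_map_closedness[OF h C] assms(2) by blast
  then have hC: "closedin (powertop_real I) (h ` C)" "h ` C \<subseteq> T"
    by (simp_all add: closedin_closed_subtopology[OF T])
  have "homeomorphic_map (subtopology X C) (subtopology (subtopology (powertop_real I) T) (h ` C)) h"
  proof (rule homeomorphic_map_subtopologies[OF h])
    show "h ` (topspace X \<inter> C) = topspace (subtopology (powertop_real I) T) \<inter> h ` C"
      using C hC closedin_subset[OF hC(1)] by auto
  qed
  then have "subtopology X C homeomorphic_space subtopology (powertop_real I) (h ` C)"
    using hC(2) homeomorphic_space by (metis subtopology_subtopology inf.absorb2)
  then show ?thesis
    using realcompact_spaceI[OF hC(1)] by blast
qed

lemma generated_ideal_eq:
  assumes "ideal_in S \<A>"
  shows "generated_ideal S \<A> = \<A>"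
  unfolding generated_ideal_def using assms by (intro equalityI Inter_greatest Inter_lower) auto

lemma hewitt_realcompactification_extension:
  assumes "continuous_map X euclideanreal f"
  obtains g where
    "continuous_map (subtopology (stone_cech X) (hewitt_realcompactification X)) euclideanreal g"
    "\<And>x. x \<in> topspace X \<Longrightarrow> g (stone_cech_map X x) = f x"
  using assms is_hewitt_realcompactification_hewitt[of X]
  unfolding is_hewitt_realcompactification_def by metis

text \<open>For Tychonoff \<open>X\<close> the map is an embedding, and closures in a subspace are
  traces of closures in the whole space.\<close>

lemma stone_cech_closure_of_Int:
  assumes "completely_regular_space X" "Hausdorff_space X" "R \<subseteq> topspace X"
  shows "stone_cech_map X ` topspace X \<inter> stone_cech X closure_of (stone_cech_map X ` R)
    = stone_cech_map X ` (X closure_of R)"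
proof -
  let ?E = "stone_cech_map X ` topspace X"
  have "subtopology (stone_cech X) ?E closure_of (stone_cech_map X ` R)
      = stone_cech_map X ` (X closure_of R)"
    using embedding_map_stone_cech_map[OF assms(1,2)] assms(3)
    unfolding embedding_map_def by (rule homeomorphic_map_closure_of)
  moreover have "?E \<inter> stone_cech_map X ` R = stone_cech_map X ` R"
    using assms(3) by blast
  ultimately show ?thesis
    by (simp add: closure_of_subtopology)
qed

lemma stone_cech_closure_of_closure:
  assumes "R \<subseteq> topspace X"
  shows "stone_cech X closure_of (stone_cech_map X ` (X closure_of R))
    = stone_cech X closure_of (stone_cech_map X ` R)"
proof
  show "stone_cech X closure_of (stone_cech_map X ` (X closure_of R))
      \<subseteq> stone_cech X closure_of (stone_cech_map X ` R)"
    by (simp add: closure_of_minimal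
        continuous_map_image_closure_subset[OF continuous_map_stone_cech_map])
  show "stone_cech X closure_of (stone_cech_map X ` R)
      \<subseteq> stone_cech X closure_of (stone_cech_map X ` (X closure_of R))"
    by (simp add: assms closure_of_mono closure_of_subset image_mono)
qed

text \<open>A closed embedding \<open>h\<close> of \<open>A\<close> into a power of the line
  extends, coordinate by coordinate, to a map \<open>H\<close> on the closure \<open>Q\<close> of
  the copy of \<open>A\<close> in \<upsilon>X. Going back through the inverse of \<open>h\<close>
  fixes the dense copy of \<open>A\<close>, hence all of \<open>Q\<close>, while landing in that
  copy.\<close>

lemma realcompact_closedin_imp_hewitt_closed:
  assumes "normal_space X" "closedin X A" "realcompact_space (subtopology X A)"
  shows "hewitt_realcompactification X \<inter> stone_cech X closure_of (stone_cech_map X ` A)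
    \<subseteq> stone_cech_map X ` A"
proof
  let ?e = "stone_cech_map X"
  let ?B = "stone_cech X"
  let ?U = "hewitt_realcompactification X"
  define Q where "Q = ?U \<inter> ?B closure_of (?e ` A)"
  fix p assume "p \<in> ?U \<inter> ?B closure_of (?e ` A)"
  then have p: "p \<in> Q" by (simp add: Q_def)
  have A: "A \<subseteq> topspace X"
    using assms(2) closedin_subset by blast
  have eU: "?e ` topspace X \<subseteq> ?U"
    using is_hewitt_realcompactification_hewitt[of X]
    unfolding is_hewitt_realcompactification_def by blast
  have topQ: "topspace (subtopology ?B Q) = Q"
    using closure_of_subset_topspace[of ?B "?e ` A"] by (auto simp: Q_def)
  have "?e ` A \<subseteq> ?B closure_of (?e ` A)"
    using A stone_cech_map_in[of X] by (intro closure_of_subset) blast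
  then have AQ: "?e ` A \<subseteq> Q"
    using A eU by (auto simp: Q_def)
  then have dense: "q \<in> subtopology ?B Q closure_of (?e ` A)" if "q \<in> Q" for q
    using that by (simp add: closure_of_subtopology inf.absorb2) (simp add: Q_def)
  obtain I :: "('a \<Rightarrow> real) set" and T where T: "closedin (powertop_real I) T"
    and "subtopology X A homeomorphic_space subtopology (powertop_real I) T"
    using assms(3) unfolding realcompact_space_def by blast
  then obtain h k where "homeomorphic_maps (subtopology X A) (subtopology (powertop_real I) T) h k"
    using homeomorphic_space_def by blast
  then have conth: "continuous_map (subtopology X A) (powertop_real I) h"
    and hT: "\<And>x. x \<in> A \<Longrightarrow> h x \<in> T"
    and contk: "continuous_map (subtopology (powertop_real I) T) (subtopology X A) k"
    and kh: "\<And>x. x \<in> A \<Longrightarrow> k (h x) = x"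
    using A by (auto simp: homeomorphic_maps_def continuous_map_in_subtopology)
  have "\<exists>g. continuous_map (subtopology ?B ?U) euclideanreal g \<and> (\<forall>x\<in>A. g (?e x) = h x i)"
    if "i \<in> I" for i
  proof -
    have "continuous_map (subtopology X A) euclideanreal (\<lambda>x. h x i)"
      using conth that by (simp add: continuous_map_componentwise)
    \<comment> \<open>Coordinates of \<open>h\<close> may be unbounded, so Tietze is applied with
      the whole line as the interval.\<close>
    then obtain f where f: "continuous_map X euclideanreal f" "\<And>x. x \<in> A \<Longrightarrow> f x = h x i"
      using Tietze_extension_realinterval[OF assms(1,2) is_interval_univ UNIV_not_empty _ subset_UNIV]
      by metis
    obtain g where "continuous_map (subtopology ?B ?U) euclideanreal g"
      "\<And>x. x \<in> topspace X \<Longrightarrow> g (?e x) = f x"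
      using hewitt_realcompactification_extension[OF f(1)] by metis
    then show ?thesis
      using A f(2) by (metis subsetD)
  qed
  then obtain g where contg: "\<And>i. i \<in> I \<Longrightarrow> continuous_map (subtopology ?B ?U) euclideanreal (g i)"
    and g: "\<And>i x. i \<in> I \<Longrightarrow> x \<in> A \<Longrightarrow> g i (?e x) = h x i"
    by metis
  define H where "H q = (\<lambda>i\<in>I. g i q)" for q
  have "continuous_map (subtopology ?B Q) euclideanreal (g i)" if "i \<in> I" for i
    using contg[OF that] by (rule continuous_map_from_subtopology_mono) (simp add: Q_def)
  then have contH: "continuous_map (subtopology ?B Q) (powertop_real I) H"
    unfolding continuous_map_componentwise by (auto simp: H_def)
  have He: "H (?e x) = h x" if x: "x \<in> A" for x
  proof -
    have "h x \<in> extensional I"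
      using closedin_subset[OF T] hT[OF x] by (auto simp: PiE_def)
    then show ?thesis
      using g x by (auto simp: H_def fun_eq_iff extensional_def)
  qed
  \<comment> \<open>Closedness of \<open>T\<close> enters here: \<open>H\<close> maps a dense subset
    of \<open>Q\<close> into \<open>T\<close>, and therefore all of \<open>Q\<close>.\<close>
  have HT: "H q \<in> T" if q: "q \<in> Q" for q
  proof (rule forall_in_closure_of[OF dense[OF q], where P="\<lambda>q. H q \<in> T"])
    show "H y \<in> T" if "y \<in> ?e ` A" for y
      using that He hT by auto
    show "closedin (subtopology ?B Q) {q \<in> topspace (subtopology ?B Q). H q \<in> T}"
      using closedin_continuous_map_preimage[OF contH T] .
  qed
  have "continuous_map (subtopology ?B Q) (subtopology (powertop_real I) T) H"
    using contH HT topQ by (auto simp: continuous_map_in_subtopology)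
  then have contkH: "continuous_map (subtopology ?B Q) (subtopology X A) (k \<circ> H)"
    using contk continuous_map_compose by blast
  have "(?e \<circ> (k \<circ> H)) p = id p"
  proof (rule forall_in_closure_of_eq[OF dense[OF p] Hausdorff_space_stone_cech[of X]])
    show "continuous_map (subtopology ?B Q) ?B (?e \<circ> (k \<circ> H))"
      using contkH continuous_map_stone_cech_map[of X] continuous_map_compose
        continuous_map_in_subtopology by blast
    show "continuous_map (subtopology ?B Q) ?B id"
      by (simp add: continuous_map_from_subtopology)
    show "(?e \<circ> (k \<circ> H)) y = id y" if "y \<in> ?e ` A" for y
      using that He kh by auto
  qed
  moreover have "(k \<circ> H) p \<in> A"
    using contkH p topQ A by (metis continuous_map_image_subset_topspace image_subset_iff
        topspace_subtopology_subset)
  ultimately show "p \<in> ?e ` A"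
    by (metis comp_apply id_apply image_eqI)
qed

text \<open>If the closure misses \<upsilon>X - X, its trace on \<upsilon>X is a copy of
  \<open>X closure_of R\<close>, closed in a realcompact space. The converse is the preceding
  lemma.\<close>

lemma realcompact_closure_of_iff:
  assumes "normal_space X" "Hausdorff_space X" "R \<subseteq> topspace X"
  shows "realcompact_space (subtopology X (X closure_of R)) \<longleftrightarrow>
    stone_cech X closure_of (stone_cech_map X ` R) \<inter>
      (hewitt_realcompactification X - stone_cech_map X ` topspace X) = {}"
    (is "?rc \<longleftrightarrow> ?C \<inter> (?U - ?E) = {}")
proof
  let ?e = "stone_cech_map X"
  let ?B = "stone_cech X"
  let ?A = "X closure_of R"
  have A: "?A \<subseteq> topspace X"
    by (rule closure_of_subset_topspace)
  show "?C \<inter> (?U - ?E) = {}" if ?rc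
    using realcompact_closedin_imp_hewitt_closed[OF assms(1) closedin_closure_of that]
      stone_cech_closure_of_closure[OF assms(3)] A by blast
  assume disj: "?C \<inter> (?U - ?E) = {}"
  have cr: "completely_regular_space X"
    using assms(1,2) normal_imp_completely_regular_space by blast
  have U: "?E \<subseteq> ?U" "realcompact_space (subtopology ?B ?U)"
    using is_hewitt_realcompactification_hewitt[of X]
    unfolding is_hewitt_realcompactification_def by blast+
  have eq: "?U \<inter> ?C = ?e ` ?A"
    using disj U(1) stone_cech_closure_of_Int[OF cr assms(2,3)] by blast
  have "closedin (subtopology ?B ?U) (?U \<inter> ?C)"
    by (simp add: closedin_subtopology_Int_closed)
  then have "realcompact_space (subtopology (subtopology ?B ?U) (?e ` ?A))"
    using realcompact_space_closed_subtopology[OF U(2)] by (simp add: eq)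
  moreover have "subtopology (subtopology ?B ?U) (?e ` ?A) = subtopology ?B (?e ` ?A)"
    using eq by (metis inf.absorb2 inf_le1 subtopology_subtopology)
  moreover have "homeomorphic_map (subtopology X ?A) (subtopology (subtopology ?B ?E) (?e ` ?A)) ?e"
    using embedding_map_stone_cech_map[OF cr assms(2)] A stone_cech_map_in[of X]
    unfolding embedding_map_def by (intro homeomorphic_map_subtopologies) auto
  moreover have "subtopology (subtopology ?B ?E) (?e ` ?A) = subtopology ?B (?e ` ?A)"
    using A by (simp add: subtopology_subtopology image_mono inf.absorb2)
  ultimately show ?rc
    using realcompact_space_homeomorphic homeomorphic_space by metis
qed

text \<open>The generators already form an ideal: closure is monotone and commutes with binary
  unions, so missing a fixed set passes to subsets and unions.\<close>

lemma realcompactness_ideal_iff: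
  assumes "normal_space X" "Hausdorff_space X"
  shows "R \<in> realcompactness_ideal X \<longleftrightarrow> R \<subseteq> topspace X \<and>
    stone_cech X closure_of (stone_cech_map X ` R) \<inter>
      (hewitt_realcompactification X - stone_cech_map X ` topspace X) = {}"
proof -
  let ?I = "{R. R \<subseteq> topspace X \<and> stone_cech X closure_of (stone_cech_map X ` R) \<inter>
      (hewitt_realcompactification X - stone_cech_map X ` topspace X) = {}}"
  have "{R. R \<subseteq> topspace X \<and> realcompact_space (subtopology X (X closure_of R))} = ?I"
    using realcompact_closure_of_iff[OF assms] by blast
  moreover have "ideal_in (topspace X) ?I"
    unfolding ideal_in_def
  proof (intro conjI ballI allI impI)
    have "{} \<in> ?I" by simp
    then show "?I \<noteq> {}" by blast
    fix A B assume A: "A \<in> ?I" "B \<subseteq> A"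
    then have "stone_cech X closure_of (stone_cech_map X ` B)
        \<subseteq> stone_cech X closure_of (stone_cech_map X ` A)"
      by (intro closure_of_mono image_mono)
    with A show "B \<in> ?I" by blast
  qed (auto simp: image_Un)
  ultimately show ?thesis
    by (simp add: realcompactness_ideal_def generated_ideal_eq)
qed

theorem theorem3p31:
  fixes X :: "'a topology"
  assumes "normal_space X" and "Hausdorff_space X"
  shows "connected_modulo_realcompactness X \<longleftrightarrow>
    connectedin (stone_cech X)
      (stone_cech X closure_of
        (hewitt_realcompactification X - stone_cech_map X ` topspace X))"
proof -
  let ?e = "stone_cech_map X"
  let ?B = "stone_cech X"
  define K where "K = hewitt_realcompactification X - ?e ` topspace X"
  note ideal = realcompactness_ideal_iff[OF assms, folded K_def]
  have KB: "K \<subseteq> topspace ?B"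
    using is_hewitt_realcompactification_hewitt[of X]
    unfolding is_hewitt_realcompactification_def K_def by blast
  have clK: "K \<subseteq> ?B closure_of K"
    using KB by (rule closure_of_subset)
  \<comment> \<open>Negating both sides gives each direction a witness: a 2-valued function or a
    separation.\<close>
  have "\<not> connected_modulo_realcompactness X \<longleftrightarrow> \<not> connectedin ?B (?B closure_of K)"
  proof
    assume "\<not> connected_modulo_realcompactness X"
    then obtain f where f: "continuous_map X (top_of_set {0..1::real}) f"
      and two: "two_valued_modulo X (realcompactness_ideal X) f"
      unfolding connected_modulo_realcompactness_def connected_modulo_def by blast
    obtain F where F: "continuous_map ?B (top_of_set {0..1}) F"
      and Fe: "\<And>x. x \<in> topspace X \<Longrightarrow> F (?e x) = f x"
      using stone_cech_extension[OF f] by metis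
    have contF: "continuous_map ?B euclideanreal F"
      using F continuous_map_in_subtopology by blast
    define Z where "Z c = {x \<in> topspace X. f x = c}" for c
    define M where "M = topspace X - (Z 0 \<union> Z 1)"
    define L where "L c = {p \<in> topspace ?B. F p \<in> {c}}" for c
    have closedL: "closedin ?B (L c)" for c
      unfolding L_def by (rule closedin_continuous_map_preimage[OF contF]) simp
    have ZL: "?B closure_of (?e ` Z c) \<subseteq> L c" for c
      using Fe stone_cech_map_in[of X]
      by (intro closure_of_minimal[OF _ closedL]) (auto simp: Z_def L_def)
    \<comment> \<open>By density the closures of the copies of \<open>Z 0\<close>,
      \<open>Z 1\<close> and \<open>M\<close> cover \<beta>X; the last misses \<open>K\<close>, so
      the first two cover \<open>K\<close>.\<close>
    have "topspace ?B = ?B closure_of (?e ` (Z 0 \<union> Z 1 \<union> M))"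
    proof -
      have "Z 0 \<union> Z 1 \<union> M = topspace X"
        by (auto simp: Z_def M_def)
      then show ?thesis by (simp only: stone_cech_map_dense)
    qed
    moreover have "?B closure_of (?e ` M) \<inter> K = {}"
      using two ideal unfolding two_valued_modulo_def M_def Z_def by blast
    ultimately have "K \<subseteq> L 0 \<union> L 1"
      using KB ZL[of 0] ZL[of 1] by (auto simp: image_Un)
    then have "?B closure_of K \<subseteq> L 0 \<union> L 1"
      by (simp add: closure_of_minimal closedL closedin_Un)
    \<comment> \<open>Otherwise the closure of the copy of \<open>Z c\<close>, which lies in
      \<open>L c\<close>, would miss \<open>K\<close> and put \<open>Z c\<close> into the
      ideal.\<close>
    moreover have "L c \<inter> K \<noteq> {}" if "c = 0 \<or> c = 1" for c
    proof -
      have "Z c \<notin> realcompactness_ideal X"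
        using two that unfolding two_valued_modulo_def Z_def by blast
      moreover have "Z c \<subseteq> topspace X"
        by (auto simp: Z_def)
      ultimately show ?thesis
        using ideal ZL[of c] by blast
    qed
    then have "L 0 \<inter> ?B closure_of K \<noteq> {}" "L 1 \<inter> ?B closure_of K \<noteq> {}"
      using clK by blast+
    moreover have "L 0 \<inter> L 1 = {}"
      by (auto simp: L_def)
    ultimately show "\<not> connectedin ?B (?B closure_of K)"
      using closedL[of 0] closedL[of 1] unfolding connectedin_closedin by blast
  next
    assume "\<not> connectedin ?B (?B closure_of K)"
    then obtain E1 E2 where E: "closedin ?B E1" "closedin ?B E2" "?B closure_of K \<subseteq> E1 \<union> E2"
      "E1 \<inter> E2 \<inter> ?B closure_of K = {}" "E1 \<inter> ?B closure_of K \<noteq> {}" "E2 \<inter> ?B closure_of K \<noteq> {}"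
      unfolding connectedin_closedin using closure_of_subset_topspace[of ?B K] by blast
    \<comment> \<open>\<open>E1\<close> and \<open>E2\<close> may meet outside the closure of
      \<open>K\<close>; cutting them down to it gives the disjoint closed sets that Urysohn's lemma
      requires.\<close>
    define G where "G = E1 \<inter> ?B closure_of K"
    define H where "H = E2 \<inter> ?B closure_of K"
    have GH: "closedin ?B G" "closedin ?B H" "disjnt G H" "K \<subseteq> G \<union> H"
      using E clK by (auto simp: G_def H_def disjnt_def)
    \<comment> \<open>A closed set containing \<open>K\<close> contains its closure, so each half of
      the separation has a point of \<open>K\<close> itself.\<close>
    have ne: "\<not> K \<subseteq> H" "\<not> K \<subseteq> G"
    proof -
      show "\<not> K \<subseteq> H"
        using E(4,5) closure_of_minimal[OF _ GH(2), of K] unfolding H_def by blast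
      show "\<not> K \<subseteq> G"
        using E(4,6) closure_of_minimal[OF _ GH(1), of K] unfolding G_def by blast
    qed
    have "normal_space ?B"
      using compact_Hausdorff_or_regular_imp_normal_space compact_space_stone_cech
        Hausdorff_space_stone_cech by blast
    txt \<open>Values outside the unit interval make the truncation \<open>f\<close> below constant near \<open>G\<close> and \<open>H\<close>.\<close>
    then obtain F where F: "continuous_map ?B (top_of_set {-1..2::real}) F"
      "F ` G \<subseteq> {-1}" "F ` H \<subseteq> {2}"
      using Urysohn_lemma[OF _ GH(1-3), of "-1" 2] by auto
    have contF: "continuous_map ?B euclideanreal F"
      using F continuous_map_in_subtopology by blast
    define f where "f = (\<lambda>x. max 0 (min 1 (F (?e x))))"
    have f: "continuous_map X (top_of_set {0..1}) f"
    proof -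
      have "continuous_map X euclideanreal (F \<circ> ?e)"
        using continuous_map_compose[OF continuous_map_stone_cech_map contF] .
      then have "continuous_map X euclideanreal (\<lambda>x. max 0 (min 1 (F (?e x))))"
        by (intro continuous_intros) (simp add: o_def)
      then show ?thesis
        by (auto simp: continuous_map_in_subtopology f_def)
    qed
    \<comment> \<open>\<open>S\<close> is a set of values truncated to \<open>c\<close>, with open
      preimage under \<open>F\<close>. Density of \<open>X\<close> makes \<open>p\<close> a limit of
      points of \<open>X\<close> with \<open>F\<close>-value in \<open>S\<close>, where
      \<open>f\<close> is \<open>c\<close>.\<close>
    have notin: "{x \<in> topspace X. f x = c} \<notin> realcompactness_ideal X"
      if W: "openin ?B {p \<in> topspace ?B. F p \<in> S}" and p: "p \<in> K" "F p \<in> S"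
        and S: "\<And>y. y \<in> S \<Longrightarrow> max 0 (min 1 y) = c" for S p c
    proof -
      have "p \<in> ?B closure_of (?e ` topspace X)"
        using p KB stone_cech_map_dense[of X] by blast
      then have "p \<in> ?B closure_of ({p \<in> topspace ?B. F p \<in> S} \<inter> ?e ` topspace X)"
        using openin_Int_closure_of_subset[OF W, of "?e ` topspace X"] p KB by blast
      moreover have "{p \<in> topspace ?B. F p \<in> S} \<inter> ?e ` topspace X
          \<subseteq> ?e ` {x \<in> topspace X. f x = c}"
        using S by (auto simp: f_def)
      ultimately have "p \<in> ?B closure_of (?e ` {x \<in> topspace X. f x = c})"
        using closure_of_mono by blast
      then show ?thesis
        using p ideal by blast
    qed
    obtain p where "p \<in> K" "p \<in> G"
      using ne GH(4) by blast
    then have 0: "{x \<in> topspace X. f x = 0} \<notin> realcompactness_ideal X"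
      using F(2) by (intro notin[of "{..<0}" p])
        (auto intro!: openin_continuous_map_preimage[OF contF, of "{..<0}", simplified])
    obtain q where "q \<in> K" "q \<in> H"
      using ne GH(4) by blast
    then have 1: "{x \<in> topspace X. f x = 1} \<notin> realcompactness_ideal X"
      using F(3) by (intro notin[of "{1<..}" q])
        (auto intro!: openin_continuous_map_preimage[OF contF, of "{1<..}", simplified])
    define M where "M = topspace X - ({x \<in> topspace X. f x = 0} \<union> {x \<in> topspace X. f x = 1})"
    \<comment> \<open>On \<open>M\<close> the values of \<open>F\<close> lie strictly between 0 and
      1, so on the closure they stay in the unit interval, away from the values -1 and 2 taken on
      \<open>K\<close>.\<close>
    have "closedin ?B {p \<in> topspace ?B. F p \<in> {0..1}}"
      by (rule closedin_continuous_map_preimage[OF contF]) simp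
    then have "?B closure_of (?e ` M) \<subseteq> {p \<in> topspace ?B. F p \<in> {0..1}}"
    proof (rule closure_of_minimal[rotated])
      show "?e ` M \<subseteq> {p \<in> topspace ?B. F p \<in> {0..1}}"
        using stone_cech_map_in[of X] by (auto simp: M_def f_def max_def min_def split: if_splits)
    qed
    then have "?B closure_of (?e ` M) \<inter> K = {}"
      using GH(4) F(2,3) by fastforce
    then have "M \<in> realcompactness_ideal X"
      using ideal by (auto simp: M_def)
    then show "\<not> connected_modulo_realcompactness X"
      using f 0 1 unfolding connected_modulo_realcompactness_def connected_modulo_def
        two_valued_modulo_def M_def by blast
  qed
  then show ?thesis
    by (simp add: K_def)
qed

end
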